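(* Let $n,q$ be coprime integers with $1<q<n$, let $\frac{n}{n-q}=[a_2,\dots,a_{e-1}]$ with $e\ge4$, and let $$F=y^N+x^{a_2-1}y^{2\alpha}z^H-xz^L\in\mathbb C[x,y,z],\qquad N=2\alpha+2s_3,\ H=2\widehat s_3,\ L=2\beta+2\widehat s_3.$$ Let $\theta=(r,u,v,w,\delta,\ell)$ be an admissible parameter, i.e. integers with $1\le r\le N-1$, $0\le u\le a_2-1$, $0\le v\le2\alpha$, $0\le w\le H$, $\delta\in\{0,1\}$, $1\le\ell\le L-1$, and put $$p_1=y^r,\quad q_1=y^{N-r},\quad p_2=x^uy^vz^w,\quad q_2=x^{a_2-1-u}y^{2\alpha-v}z^{H-w},$$ $$p_3=(-1)^\delta x^\delta z^\ell,\quad q_3=(-1)^{1-\delta}x^{1-\delta}z^{L-\ell},$$ $$\Phi_\theta=\begin{pmatrix} p_1 & -q_2 & -q_3 & 0 \\ p_2 & q_1 & 0 & -q_3 \\ p_3 & 0 & q_1 & q_2 \\ 0 & p_3 & -p_2 & p_1 \end{pmatrix},\qquad \Psi_\theta=\begin{pmatrix} q_1 & q_2 & q_3 & 0 \\ -p_2 & p_1 & 0 & q_3 \\ -p_3 & 0 & p_1 & -q_2 \\ 0 & -p_3 & p_2 & q_1 \end{pmatrix}.$$ Then, for every admissible $\theta$, $\Phi_\theta\Psi_\theta=\Psi_\theta\Phi_\theta=F\,\mathrm{Id}_4$. Hence $(\Phi_\theta,\Psi_\theta)$ is a $4\times4$ matrix factorization of $F$.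
   Context: $[c_1,\dots,c_m]=c_1-\cfrac{1}{c_2-\cfrac{1}{\ddots-\cfrac1{c_m}}}$ with integers $c_i\ge2$. A $4\times4$ matrix factorization of $F$ is a pair of $4\times4$ matrices over $\mathbb C[x,y,z]$ with both products equal to $F\,\mathrm{Id}_4$. Exponents. For $e\ge5$: $s_e=0$, $s_{e-1}=1$, $s_{e-2}=a_{e-1}$, and $s_j=(a_{j+1}-1)s_{j+1}+(a_{j+2}-1)s_{j+2}-s_{j+3}$ for $3\le j\le e-3$; $\widehat s_{e-1}=0$, $\widehat s_{e-2}=1$, $\widehat s_{e-3}=a_{e-2}$, and $\widehat s_j=(a_{j+1}-1)\widehat s_{j+1}+(a_{j+2}-1)\widehat s_{j+2}-\widehat s_{j+3}$ for $3\le j\le e-4$; $\alpha=1+\sum_{j=3}^{e-1}(a_j-2)s_j$, $\beta=1+\sum_{j=3}^{e-2}(a_j-2)\widehat s_j$. For $e=4$: $s_3=1$, $\widehat s_3=0$, $\alpha=a_3-1$, $\beta=1$. *)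

theory Defs
  imports "HOL-Analysis.Analysis" "HOL-Library.Poly_Mapping"
begin

datatype xyz = X | Y | Z

text \<open>The polynomial ring over the complex numbers in three variables is the monoid algebra of the
  free commutative monoid on \<open>X\<close>, \<open>Y\<close>, \<open>Z\<close>; multiplication on \<^type>\<open>poly_mapping\<close> is
  convolution.\<close>

type_synonym poly3 = "(xyz \<Rightarrow>\<^sub>0 nat) \<Rightarrow>\<^sub>0 complex"

definition poly_var :: "xyz \<Rightarrow> poly3" where
  "poly_var i = Poly_Mapping.single (Poly_Mapping.single i 1) 1"

abbreviation x_var :: poly3 where "x_var \<equiv> poly_var X"
abbreviation y_var :: poly3 where "y_var \<equiv> poly_var Y"
abbreviation z_var :: poly3 where "z_var \<equiv> poly_var Z"

text \<open>Here \<open>mat F\<close> is the scalar matrix with diagonal entries \<open>F\<close>.\<close>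

definition matrix_factorization4 :: "poly3 \<Rightarrow> poly3^4^4 \<Rightarrow> poly3^4^4 \<Rightarrow> bool" where
  "matrix_factorization4 F A B \<longleftrightarrow> A ** B = mat F \<and> B ** A = mat F"

definition matrix4 :: "'a::zero list list \<Rightarrow> 'a^4^4" where
  "matrix4 xss = vector (map vector xss)"

text \<open>The value on \<open>[]\<close> is a dummy. If all entries are at least 2, every denominator is greater
  than 1, so no division by zero occurs.\<close>

fun hj_cfrac :: "int list \<Rightarrow> rat" where
  "hj_cfrac [] = 0"
| "hj_cfrac [c] = of_int c"
| "hj_cfrac (c # d # cs) = of_int c - 1 / hj_cfrac (d # cs)"

text \<open>The exponents. The sequence \<open>a\<^sub>2, \<dots>, a\<^sub>e\<^sub>-\<^sub>1\<close> is the restriction of \<open>a :: nat \<Rightarrow> int\<close> to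
  \<open>{2..e - 1}\<close>. The two functions below are the descending recursions for \<open>s\<close> and \<open>s\<close> with a hat;
  their prescribed values for \<open>e = 4\<close> (namely 1 and 0 at index 3) come from the initial
  conditions. Only indices between 3 and \<open>e\<close> (\<open>e - 1\<close> for the hat version) are meaningful.\<close>

function s_exp :: "nat \<Rightarrow> (nat \<Rightarrow> int) \<Rightarrow> nat \<Rightarrow> int" where
  "s_exp e a j =
    (if j \<ge> e then 0
     else if j + 1 = e then 1
     else if j + 2 = e then a (e - 1)
     else (a (j + 1) - 1) * s_exp e a (j + 1) + (a (j + 2) - 1) * s_exp e a (j + 2)
          - s_exp e a (j + 3))"
  by pat_completeness auto
termination by (relation "Wellfounded.measure (\<lambda>(e, a, j). e - j)") auto

function s_hat :: "nat \<Rightarrow> (nat \<Rightarrow> int) \<Rightarrow> nat \<Rightarrow> int" where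
  "s_hat e a j =
    (if j + 1 \<ge> e then 0
     else if j + 2 = e then 1
     else if j + 3 = e then a (e - 2)
     else (a (j + 1) - 1) * s_hat e a (j + 1) + (a (j + 2) - 1) * s_hat e a (j + 2)
          - s_hat e a (j + 3))"
  by pat_completeness auto
termination by (relation "Wellfounded.measure (\<lambda>(e, a, j). e - j)") auto

declare s_exp.simps [simp del] s_hat.simps [simp del]

definition alpha_exp :: "nat \<Rightarrow> (nat \<Rightarrow> int) \<Rightarrow> int" where
  "alpha_exp e a = (if e = 4 then a 3 - 1 else 1 + (\<Sum>j = 3..e - 1. (a j - 2) * s_exp e a j))"

definition beta_exp :: "nat \<Rightarrow> (nat \<Rightarrow> int) \<Rightarrow> int" where
  "beta_exp e a = (if e = 4 then 1 else 1 + (\<Sum>j = 3..e - 2. (a j - 2) * s_hat e a j))"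

definition N_exp :: "nat \<Rightarrow> (nat \<Rightarrow> int) \<Rightarrow> int" where
  "N_exp e a = 2 * alpha_exp e a + 2 * s_exp e a 3"

definition H_exp :: "nat \<Rightarrow> (nat \<Rightarrow> int) \<Rightarrow> int" where
  "H_exp e a = 2 * s_hat e a 3"

definition L_exp :: "nat \<Rightarrow> (nat \<Rightarrow> int) \<Rightarrow> int" where
  "L_exp e a = 2 * beta_exp e a + 2 * s_hat e a 3"

text \<open>All exponents are integers and are converted by \<open>nat\<close>. For \<open>a\<^sub>j \<ge> 2\<close> the conversion is
  lossless, see \<open>exponents_nonneg\<close> below.\<close>

definition F_poly :: "nat \<Rightarrow> (nat \<Rightarrow> int) \<Rightarrow> poly3" where
  "F_poly e a = y_var ^ nat (N_exp e a)
     + x_var ^ nat (a 2 - 1) * y_var ^ nat (2 * alpha_exp e a) * z_var ^ nat (H_exp e a)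
     - x_var * z_var ^ nat (L_exp e a)"

text \<open>A parameter is a tuple \<open>(r, u, v, w, \<delta>, l)\<close>.\<close>

type_synonym param = "int \<times> int \<times> int \<times> int \<times> int \<times> int"

fun admissible :: "nat \<Rightarrow> (nat \<Rightarrow> int) \<Rightarrow> param \<Rightarrow> bool" where
  "admissible e a (r, u, v, w, \<delta>, l) \<longleftrightarrow>
     1 \<le> r \<and> r \<le> N_exp e a - 1 \<and>
     0 \<le> u \<and> u \<le> a 2 - 1 \<and>
     0 \<le> v \<and> v \<le> 2 * alpha_exp e a \<and>
     0 \<le> w \<and> w \<le> H_exp e a \<and>
     \<delta> \<in> {0, 1} \<and>
     1 \<le> l \<and> l \<le> L_exp e a - 1"

fun p1 :: "param \<Rightarrow> poly3" where
  "p1 (r, u, v, w, \<delta>, l) = y_var ^ nat r"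

fun q1 :: "nat \<Rightarrow> (nat \<Rightarrow> int) \<Rightarrow> param \<Rightarrow> poly3" where
  "q1 e a (r, u, v, w, \<delta>, l) = y_var ^ nat (N_exp e a - r)"

fun p2 :: "param \<Rightarrow> poly3" where
  "p2 (r, u, v, w, \<delta>, l) = x_var ^ nat u * y_var ^ nat v * z_var ^ nat w"

fun q2 :: "nat \<Rightarrow> (nat \<Rightarrow> int) \<Rightarrow> param \<Rightarrow> poly3" where
  "q2 e a (r, u, v, w, \<delta>, l) =
     x_var ^ nat (a 2 - 1 - u) * y_var ^ nat (2 * alpha_exp e a - v) * z_var ^ nat (H_exp e a - w)"

fun p3 :: "param \<Rightarrow> poly3" where
  "p3 (r, u, v, w, \<delta>, l) = (- 1) ^ nat \<delta> * x_var ^ nat \<delta> * z_var ^ nat l"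

fun q3 :: "nat \<Rightarrow> (nat \<Rightarrow> int) \<Rightarrow> param \<Rightarrow> poly3" where
  "q3 e a (r, u, v, w, \<delta>, l) =
     (- 1) ^ nat (1 - \<delta>) * x_var ^ nat (1 - \<delta>) * z_var ^ nat (L_exp e a - l)"

definition Phi :: "nat \<Rightarrow> (nat \<Rightarrow> int) \<Rightarrow> param \<Rightarrow> poly3^4^4" where
  "Phi e a \<theta> = matrix4
     [[p1 \<theta>, - q2 e a \<theta>, - q3 e a \<theta>, 0],
      [p2 \<theta>, q1 e a \<theta>, 0, - q3 e a \<theta>],
      [p3 \<theta>, 0, q1 e a \<theta>, q2 e a \<theta>],
      [0, p3 \<theta>, - p2 \<theta>, p1 \<theta>]]"

definition Psi :: "nat \<Rightarrow> (nat \<Rightarrow> int) \<Rightarrow> param \<Rightarrow> poly3^4^4" where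
  "Psi e a \<theta> = matrix4
     [[q1 e a \<theta>, q2 e a \<theta>, q3 e a \<theta>, 0],
      [- p2 \<theta>, p1 \<theta>, 0, q3 e a \<theta>],
      [- p3 \<theta>, 0, p1 \<theta>, - q2 e a \<theta>],
      [0, - p3 \<theta>, p2 \<theta>, q1 e a \<theta>]]"

lemma s_rec: "j + 2 \<le> e \<Longrightarrow> s_exp e a j = a (j+1) * s_exp e a (j+1) - s_exp e a (j+2)"
proof (induction "e - j" arbitrary: j rule: less_induct)
  case less
  consider "j + 2 = e" | "j + 3 = e" | "j + 4 \<le> e" using less.prems by linarith
  then show ?case
  proof cases
    case 1
    have "s_exp e a (j+1) = 1" by (subst s_exp.simps) (use 1 in auto)
    moreover have "s_exp e a (j+2) = 0" by (subst s_exp.simps) (use 1 in auto)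
    moreover have "s_exp e a j = a (e - 1)" by (subst s_exp.simps) (use 1 in auto)
    moreover have "e - 1 = j + 1" using 1 by simp
    ultimately show ?thesis by simp
  next
    case 2
    have "s_exp e a (j+1) = a (j+1+1) * s_exp e a (j+1+1) - s_exp e a (j+1+2)"
      by (rule less.hyps) (use 2 in auto)
    moreover have "s_exp e a j = (a (j + 1) - 1) * s_exp e a (j + 1) + (a (j + 2) - 1) * s_exp e a (j + 2)
          - s_exp e a (j + 3)" using 2 by (subst s_exp.simps) auto
    ultimately show ?thesis by (simp add: algebra_simps numeral_eq_Suc)
  next
    case 3
    have "s_exp e a (j+1) = a (j+1+1) * s_exp e a (j+1+1) - s_exp e a (j+1+2)"
      by (rule less.hyps) (use 3 in auto)
    moreover have "s_exp e a j = (a (j + 1) - 1) * s_exp e a (j + 1) + (a (j + 2) - 1) * s_exp e a (j + 2)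
          - s_exp e a (j + 3)" using 3 by (subst s_exp.simps) auto
    ultimately show ?thesis by (simp add: algebra_simps numeral_eq_Suc)
  qed
qed

lemma s_hat_eq: "2 \<le> e \<Longrightarrow> s_hat e a j = s_exp (e - 1) a j"
proof (induction "e - j" arbitrary: j rule: less_induct)
  case less
  consider "j + 1 \<ge> e" | "j + 2 = e" | "j + 3 = e" | "j + 4 \<le> e" by linarith
  then show ?case
  proof cases
    case 4
    have "s_hat e a (j+1) = s_exp (e-1) a (j+1)" "s_hat e a (j+2) = s_exp (e-1) a (j+2)"
      "s_hat e a (j+3) = s_exp (e-1) a (j+3)"
      by (rule less.hyps; use 4 less.prems in auto)+
    then show ?thesis using 4 by (subst s_exp.simps, subst s_hat.simps) auto
  qed (subst s_exp.simps, subst s_hat.simps, auto simp: numeral_eq_Suc)+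
qed

lemma s_exp_mono:
  assumes "\<And>i. j < i \<Longrightarrow> i < e \<Longrightarrow> 2 \<le> a i" "j < e"
  shows "0 \<le> s_exp e a (j+1) \<and> s_exp e a (j+1) + 1 \<le> s_exp e a j"
  using assms
proof (induction "e - j" arbitrary: j rule: less_induct)
  case less
  show ?case
  proof (cases "j + 1 = e")
    case True then show ?thesis by (auto simp: s_exp.simps)
  next
    case False
    then have j: "j + 2 \<le> e" using less.prems by linarith
    have ih: "0 \<le> s_exp e a (j+1+1) \<and> s_exp e a (j+1+1) + 1 \<le> s_exp e a (j+1)"
      by (rule less.hyps) (use j less.prems in auto)
    have "2 * s_exp e a (j+1) \<le> a (j+1) * s_exp e a (j+1)"
      by (rule mult_right_mono) (use ih j less.prems(1)[of "j+1"] in auto)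
    moreover have "s_exp e a j = a (j+1) * s_exp e a (j+1) - s_exp e a (j+1+1)"
      using s_rec[OF j, of a] by (simp add: numeral_eq_Suc)
    ultimately show ?thesis using ih by linarith
  qed
qed

lemma s_exp_nonneg:
  assumes "\<And>i. j < i \<Longrightarrow> i < e \<Longrightarrow> 2 \<le> a i"
  shows "0 \<le> s_exp e a j"
proof (cases "j < e")
  case True
  have "0 \<le> s_exp e a (j+1) \<and> s_exp e a (j+1) + 1 \<le> s_exp e a j"
    by (rule s_exp_mono) (use assms True in auto)
  then show ?thesis by linarith
next
  case False then show ?thesis by (simp add: s_exp.simps)
qed

lemma exponents_nonneg:
  assumes "4 \<le> e" and a: "\<forall>j\<in>{2..e - 1}. 2 \<le> a j"
  shows "1 \<le> a 2 - 1" "1 \<le> s_exp e a 3" "0 \<le> s_hat e a 3" "1 \<le> alpha_exp e a" "1 \<le> beta_exp e a"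
proof -
  have s: "0 \<le> s_exp e a j" if "j \<ge> 3" for j by (rule s_exp_nonneg) (use a that in auto)
  have h: "0 \<le> s_hat e a j" if "j \<ge> 3" for j
    unfolding s_hat_eq[OF order.trans[OF _ assms(1)], simplified]
    using s_exp_nonneg[of j "e-1" a] a that assms(1) s_hat_eq[of e a j] by auto
  show "1 \<le> a 2 - 1" using bspec[OF a, of 2] assms(1) by fastforce
  show "1 \<le> s_exp e a 3" using s_exp_mono[of 3 e a] assms by auto
  show "0 \<le> s_hat e a 3" using h by simp
  have "0 \<le> (\<Sum>j = 3..e - 1. (a j - 2) * s_exp e a j)"
    by (rule sum_nonneg, rule mult_nonneg_nonneg) (use a s in auto)
  moreover have "a 3 - 1 \<ge> 1" using bspec[OF a, of 3] assms(1) by fastforce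
  ultimately show "1 \<le> alpha_exp e a" by (auto simp: alpha_exp_def)
  have "0 \<le> (\<Sum>j = 3..e - 2. (a j - 2) * s_hat e a j)"
    by (rule sum_nonneg, rule mult_nonneg_nonneg) (use a h in auto)
  then show "1 \<le> beta_exp e a" by (auto simp: beta_exp_def)
qed

end

theory Submission
  imports Defs
begin

text \<open>The matrices are the Koszul matrix factorization attached to a decomposition
  \<open>F = p\<^sub>1 q\<^sub>1 + p\<^sub>2 q\<^sub>2 + p\<^sub>3 q\<^sub>3\<close>; the products \<open>p\<^sub>i q\<^sub>i\<close> are the three terms of \<open>F\<close>,
  the sign \<open>(-1)\<^sup>\<delta> (-1)\<^sup>1\<^sup>-\<^sup>\<delta> = -1\<close> giving the last one.\<close>

lemma vector_4:
  fixes w x y z :: "'a::zero"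
  shows "(vector [w, x, y, z] :: 'a^4) $ 1 = w" and "(vector [w, x, y, z] :: 'a^4) $ 2 = x"
    and "(vector [w, x, y, z] :: 'a^4) $ 3 = y" and "(vector [w, x, y, z] :: 'a^4) $ 4 = z"
  unfolding vector_def by simp_all

text \<open>By commutativity each off-diagonal entry of either product is a difference of two equal
  products, while each diagonal entry collects all three \<open>p_i * q_i\<close>.\<close>

lemma matrix4_mult_koszul:
  fixes p1 p2 p3 q1 q2 q3 :: "'a::comm_ring_1"
  defines "A \<equiv> matrix4 [[p1, - q2, - q3, 0], [p2, q1, 0, - q3], [p3, 0, q1, q2], [0, p3, - p2, p1]]"
    and "B \<equiv> matrix4 [[q1, q2, q3, 0], [- p2, p1, 0, q3], [- p3, 0, p1, - q2], [0, - p3, p2, q1]]"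
  shows "A ** B = mat (p1 * q1 + p2 * q2 + p3 * q3)"
    and "B ** A = mat (p1 * q1 + p2 * q2 + p3 * q3)"
  by (simp_all add: A_def B_def matrix4_def matrix_matrix_mult_def mat_def vec_eq_iff
      forall_4 sum_4 vector_4 algebra_simps)

text \<open>The bounds keep \<open>nat\<close> from truncating a negative exponent to 0, so the
  exponents really add up.\<close>

lemma power_nat_mult_power_nat_diff:
  fixes x :: "'a::monoid_mult"
  assumes "0 \<le> k" "k \<le> m"
  shows "x ^ nat k * x ^ nat (m - k) = x ^ nat m"
  using assms by (simp flip: power_add nat_add_distrib)

lemma F_poly_eq:
  assumes "admissible e a \<theta>"
  shows "F_poly e a = p1 \<theta> * q1 e a \<theta> + p2 \<theta> * q2 e a \<theta> + p3 \<theta> * q3 e a \<theta>"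
proof -
  obtain r u v w \<delta> l where \<theta>: "\<theta> = (r, u, v, w, \<delta>, l)"
    by (cases \<theta>)
  have "p1 \<theta> * q1 e a \<theta> = y_var ^ nat (N_exp e a)"
    using assms by (simp add: \<theta> power_nat_mult_power_nat_diff)
  moreover have "p2 \<theta> * q2 e a \<theta> =
      (x_var ^ nat u * x_var ^ nat (a 2 - 1 - u)) *
      (y_var ^ nat v * y_var ^ nat (2 * alpha_exp e a - v)) *
      (z_var ^ nat w * z_var ^ nat (H_exp e a - w))"
    by (simp add: \<theta> ac_simps)
  then have "p2 \<theta> * q2 e a \<theta> =
      x_var ^ nat (a 2 - 1) * y_var ^ nat (2 * alpha_exp e a) * z_var ^ nat (H_exp e a)"
    using assms[unfolded \<theta>] by (simp add: power_nat_mult_power_nat_diff)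
  \<comment> \<open>For either value of \<delta>, exactly one of \<open>p3\<close> and
    \<open>q3\<close> carries the whole factor \<open>- x_var\<close>.\<close>
  moreover have "p3 \<theta> * q3 e a \<theta> = - x_var * (z_var ^ nat l * z_var ^ nat (L_exp e a - l))"
    using assms by (auto simp: \<theta> mult.assoc mult.left_commute)
  then have "p3 \<theta> * q3 e a \<theta> = - x_var * z_var ^ nat (L_exp e a)"
    using assms[unfolded \<theta>] by (simp add: power_nat_mult_power_nat_diff)
  ultimately show ?thesis
    by (simp add: F_poly_def)
qed

theorem proposition6p1:
  fixes n q :: int and e :: nat and a :: "nat \<Rightarrow> int" and \<theta> :: param
  assumes "coprime n q" and "1 < q" and "q < n"
    and "4 \<le> e"
    and "\<forall>j\<in>{2..e - 1}. 2 \<le> a j"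
    and "of_int n / of_int (n - q) = hj_cfrac (map a [2..<e])"
    and "admissible e a \<theta>"
  shows "Phi e a \<theta> ** Psi e a \<theta> = mat (F_poly e a)
    \<and> Psi e a \<theta> ** Phi e a \<theta> = mat (F_poly e a)
    \<and> matrix_factorization4 (F_poly e a) (Phi e a \<theta>) (Psi e a \<theta>)"
  \<comment> \<open>With \<open>F\<close> split into the \<open>p_i * q_i\<close>, every conjunct is
    an instance of the generic identity.\<close>
  unfolding matrix_factorization4_def F_poly_eq[OF assms(7)] Phi_def Psi_def
  by (intro conjI matrix4_mult_koszul)

end
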